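(* There exist a universal constant $C>0$ and an integer $r_0$ such that for every integer $r\ge r_0$ the following holds. Set $d=2^{2r}$, $m=\sqrt d$ and $I=\{1,\dots,m\}$. There are orthogonal matrices $A,B\in O(d)$ and a vector $x\in\mathbb S^{d-1}$ such that $$\kappa_I(A)=1,\qquad\Theta_B(\{x\})=1,$$ but the random linear map $\Phi=\sqrt{\frac dm}\,P_IAD_\xi P_\pi BD_{\xi'}:\mathbb R^d\to\mathbb R^m$ satisfies $$\mathbb P\left\{\bigl|\|\Phi x\|_2^2-1\bigr|\ge3\right\}\ge\exp\left[-Cd^{1/3}(\log d)^{2/3}\right].$$
   Context: $O(d)$ is the group of real orthogonal $d\times d$ matrices, $\mathbb S^{d-1}$ the Euclidean unit sphere of $\mathbb R^d$, $[d]=\{1,\dots,d\}$. $P_I\in\mathbb R^{m\times d}$ is restriction to the coordinates in $I$. $\xi,\xi'$ are uniform on $\{-1,1\}^d$, $\pi$ is a uniform permutation in $S_d$, and $\xi,\xi',\pi$ are independent; $D_\xi=\operatorname{diag}(\xi_1,\dots,\xi_d)$, and $P_\pi$ is the permutation matrix with $(P_\pi x)_k=x_{\pi(k)}$. For $|I|=m$, $\kappa_I(A)=\frac dm\max_{k\in[d]}\sum_{j\in I}A_{jk}^2$, and for $X\subseteq\mathbb S^{d-1}$, $\Theta_B(X)=d\sup_{x\in X,\,k\in[d]}\sum_{j=1}^dB_{kj}^2x_j^2$. *)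

theory Defs
  imports
    "HOL-Probability.Probability"
    "HOL-Combinatorics.Permutations"
    "Jordan_Normal_Form.DL_Submatrix"
begin

text \<open>The dimension is quantified inside the theorem, so vectors and matrices are those of the
  Jordan normal form library. Coordinates are 0-based: the index set \<open>[d]\<close> is \<open>{..<d}\<close>.\<close>

unbundle no vec_syntax
hide_const (open) Finite_Cartesian_Product.vec Finite_Cartesian_Product.mat
  Finite_Cartesian_Product.transpose

definition orthogonal_group :: "nat \<Rightarrow> real mat set" where
  "orthogonal_group d = {A \<in> carrier_mat d d. transpose_mat A * A = 1\<^sub>m d}"

definition l2_norm :: "real vec \<Rightarrow> real" where
  "l2_norm v = L2_set (\<lambda>i. v $ i) {..<dim_vec v}"

definition unit_sphere :: "nat \<Rightarrow> real vec set" where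
  "unit_sphere d = {x \<in> carrier_vec d. l2_norm x = 1}"

text \<open>The rows of the identity matrix whose indices lie in \<open>I\<close>, in increasing order.\<close>

definition restrict_mat :: "nat \<Rightarrow> nat set \<Rightarrow> real mat" where
  "restrict_mat d I = submatrix (1\<^sub>m d) I UNIV"

definition perm_mat :: "nat \<Rightarrow> (nat \<Rightarrow> nat) \<Rightarrow> real mat" where
  "perm_mat d p = mat d d (\<lambda>(k, j). if j = p k then 1 else 0)"

lemma perm_mat_mult_vec:
  assumes "p permutes {..<d}" "x \<in> carrier_vec d" "k < d"
  shows "(perm_mat d p *\<^sub>v x) $ k = x $ p k"
proof -
  have "p k < d" using assms(1,3) permutes_in_image[OF assms(1), of k] by simp
  have "(perm_mat d p *\<^sub>v x) $ k = (\<Sum>j = 0..<d. (if j = p k then 1 else 0) * x $ j)"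
    using assms(2,3) by (simp add: perm_mat_def scalar_prod_def)
  also have "\<dots> = (\<Sum>j = 0..<d. if j = p k then x $ j else 0)"
    by (rule sum.cong) auto
  also have "\<dots> = x $ p k" using \<open>p k < d\<close> by simp
  finally show ?thesis .
qed

definition kappa :: "nat set \<Rightarrow> real mat \<Rightarrow> real" where
  "kappa I A = real (dim_col A) / real (card I) *
     Max ((\<lambda>k. \<Sum>j\<in>I. (A $$ (j, k))\<^sup>2) ` {..<dim_col A})"

definition Theta :: "real mat \<Rightarrow> real vec set \<Rightarrow> real" where
  "Theta B X = real (dim_row B) *
     (SUP (x, k) \<in> X \<times> {..<dim_row B}. \<Sum>j<dim_col B. (B $$ (k, j))\<^sup>2 * (x $ j)\<^sup>2)"

definition sign_vecs :: "nat \<Rightarrow> real vec set" where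
  "sign_vecs d = {v \<in> carrier_vec d. \<forall>i<d. v $ i \<in> {-1, 1}}"

lemma sign_vecs_nonempty: "sign_vecs d \<noteq> {}"
proof -
  have "vec d (\<lambda>_. 1) \<in> sign_vecs d" by (auto simp: sign_vecs_def)
  then show ?thesis by blast
qed

lemma finite_sign_vecs: "finite (sign_vecs d)"
proof -
  have "sign_vecs d \<subseteq> vec d ` ({..<d} \<rightarrow>\<^sub>E {-1, 1})"
  proof
    fix v assume v: "v \<in> sign_vecs d"
    let ?f = "restrict (\<lambda>i. v $ i) {..<d}"
    have "v = vec d ?f" using v by (auto simp: sign_vecs_def)
    moreover have "?f \<in> {..<d} \<rightarrow>\<^sub>E {-1, 1}" using v by (auto simp: sign_vecs_def)
    ultimately show "v \<in> vec d ` ({..<d} \<rightarrow>\<^sub>E {-1, 1})" by blast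
  qed
  then show ?thesis by (rule finite_subset) (auto intro: finite_PiE)
qed

text \<open>The joint law of \<open>(\<xi>, \<pi>, \<xi>')\<close>: independent and uniform in each component.\<close>

definition sign_perm_pmf :: "nat \<Rightarrow> (real vec \<times> (nat \<Rightarrow> nat) \<times> real vec) pmf" where
  "sign_perm_pmf d =
     pair_pmf (pmf_of_set (sign_vecs d))
       (pair_pmf (pmf_of_set {p. p permutes {..<d}}) (pmf_of_set (sign_vecs d)))"

definition Phi ::
    "nat \<Rightarrow> nat set \<Rightarrow> real mat \<Rightarrow> real mat \<Rightarrow> real vec \<times> (nat \<Rightarrow> nat) \<times> real vec \<Rightarrow> real mat" where
  "Phi d I A B = (\<lambda>(xi, p, xi').
     sqrt (real d / real (card I)) \<cdot>\<^sub>m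
       (restrict_mat d I * A * mat_diag d (\<lambda>i. xi $ i) * perm_mat d p * B *
          mat_diag d (\<lambda>i. xi' $ i)))"

end

theory Submission
  imports Defs "HOL-Real_Asymp.Real_Asymp"
begin

text \<open>Take \<open>A = B = H / \<surd>d\<close> with \<open>H\<close> the Sylvester--Walsh matrix and \<open>x\<close> flat on \<open>{..<s}\<close>, where
  \<open>s = 2 ^ t\<close>. If \<open>\<xi>'\<close> is \<open>1\<close> on \<open>{..<s}\<close>, then \<open>B D\<^bsub>\<xi>'\<^esub> x\<close> is \<open>\<surd>(s/d)\<close> times the indicator
  of the multiples of \<open>s\<close>. The columns of \<open>A\<close> restricted to the first \<open>m\<close> rows depend only on the
  index mod \<open>m\<close>, so when \<open>\<pi>\<close> fixes \<open>k \<ge> 2 \<surd>(d/s)\<close> multiples of \<open>m\<close> and the corresponding signs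
  of \<open>\<xi>\<close> agree, these coordinates add up coherently and alone contribute \<open>k\<^sup>2 s / d \<ge> 4\<close> to the
  squared norm. The event costs \<open>2 powr - s\<close> for \<open>\<xi>'\<close>, \<open>d powr - k\<close> for \<open>\<pi>\<close> and \<open>2 powr - k\<close>
  for \<open>\<xi>\<close>, balanced at \<open>s \<approx> d powr (1/3) * ln d powr (2/3)\<close>.\<close>

subsection \<open>Walsh functions\<close>

text \<open>The value is (-1)^n, where n counts the binary digits equal to 1 in both
  \<open>i\<close> and \<open>j\<close>: these are the characters of the groups (Z/2)^r, with
  indices read as digit strings. No dimension enters, so one function serves the sizes d, m and s
  alike.\<close>

fun walsh :: "nat \<Rightarrow> nat \<Rightarrow> real" where
  "walsh i j = (if i = 0 \<or> j = 0 then 1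
     else (if odd i \<and> odd j then -1 else 1) * walsh (i div 2) (j div 2))"

declare walsh.simps [simp del]

lemma walsh_0 [simp]: "walsh 0 j = 1" "walsh i 0 = 1"
  by (simp_all add: walsh.simps)

text \<open>If an index is 0, both sides are 1; hence the lowest digits split off in every
  case.\<close>

lemma walsh_rec: "walsh i j = (if odd i \<and> odd j then -1 else 1) * walsh (i div 2) (j div 2)"
  by (cases "i = 0 \<or> j = 0") (auto simp: walsh.simps[of i j])

lemma walsh_commute: "walsh i j = walsh j i"
proof (induction i j rule: walsh.induct)
  case (1 i j)
  then show ?case
    by (cases "i = 0 \<or> j = 0") (auto simp: walsh.simps[of i j] walsh.simps[of j i])
qed

lemma walsh_square [simp]: "(walsh i j)\<^sup>2 = 1"
proof (induction i j rule: walsh.induct)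
  case (1 i j)
  then show ?case
    by (cases "i = 0 \<or> j = 0") (auto simp: walsh.simps[of i j])
qed

lemma sum_lessThan_double:
  fixes f :: "nat \<Rightarrow> 'a::comm_monoid_add"
  shows "(\<Sum>i<2 * n. f i) = (\<Sum>i<n. f (2 * i) + f (2 * i + 1))"
  by (induction n) (auto simp: add.assoc)

text \<open>The sum factors over the \<open>r\<close> lowest binary digits of \<open>j\<close>: a
  digit 0 gives 1 + 1, a digit 1 gives 1 - 1. The index \<open>j\<close> is unbounded because it
  will run below d while \<open>i\<close> runs only over the first m rows or the s support
  points.\<close>

lemma sum_walsh: "(\<Sum>i<2 ^ r. walsh i j) = (if 2 ^ r dvd j then 2 ^ r else 0)"
proof (induction r arbitrary: j)
  case (Suc r)
  \<comment> \<open>The indices 2i and 2i + 1 differ only in the lowest digit: their terms agree if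
    \<open>j\<close> is even and cancel if \<open>j\<close> is odd.\<close>
  have "walsh (2 * i) j + walsh (2 * i + 1) j = (if even j then 2 else 0) * walsh i (j div 2)" for i
    by (simp add: walsh_rec[of _ j])
  then have "(\<Sum>i<2 ^ Suc r. walsh i j) =
      (if even j then 2 else 0) * (\<Sum>i<2 ^ r. walsh i (j div 2))"
    by (simp only: power_Suc sum_lessThan_double sum_distrib_left)
  moreover have "2 ^ Suc r dvd j \<longleftrightarrow> even j \<and> 2 ^ r dvd j div 2"
    by (auto elim!: evenE dest: dvd_mult_left)
  ultimately show ?case by (auto simp: Suc.IH)
qed simp

text \<open>The product is a character determined by the digits in which \<open>i\<close> and
  \<open>j\<close> differ, so the same pairing applies. The bounds make \<open>i\<close> and
  \<open>j\<close> equal once their \<open>r\<close> lowest digits agree.\<close>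

lemma sum_walsh_mult:
  assumes "i < 2 ^ r" "j < 2 ^ r"
  shows "(\<Sum>k<2 ^ r. walsh k i * walsh k j) = (if i = j then 2 ^ r else 0)"
  using assms
proof (induction r arbitrary: i j)
  case (Suc r)
  have "walsh (2 * k) i * walsh (2 * k) j + walsh (2 * k + 1) i * walsh (2 * k + 1) j =
      (if odd i = odd j then 2 else 0) * (walsh k (i div 2) * walsh k (j div 2))" for k
    by (auto simp: walsh_rec[of _ i] walsh_rec[of _ j])
  then have "(\<Sum>k<2 ^ Suc r. walsh k i * walsh k j) =
      (if odd i = odd j then 2 else 0) * (\<Sum>k<2 ^ r. walsh k (i div 2) * walsh k (j div 2))"
    by (simp only: power_Suc sum_lessThan_double sum_distrib_left)
  also have "(\<Sum>k<2 ^ r. walsh k (i div 2) * walsh k (j div 2)) =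
      (if i div 2 = j div 2 then 2 ^ r else 0)"
    using Suc.prems by (intro Suc.IH) auto
  also have "i = j \<longleftrightarrow> odd i = odd j \<and> i div 2 = j div 2"
    by presburger
  ultimately show ?case by auto
qed simp

section \<open>Normalised Walsh matrices and their parameters\<close>

definition walsh_mat :: "nat \<Rightarrow> real mat" where
  "walsh_mat d = mat d d (\<lambda>(i, j). walsh i j / sqrt (real d))"

lemma walsh_mat_carrier [simp]: "walsh_mat d \<in> carrier_mat d d"
  by (simp add: walsh_mat_def)

lemma walsh_mat_orthogonal: "walsh_mat (2 ^ r) \<in> orthogonal_group (2 ^ r)"
proof -
  have "(transpose_mat (walsh_mat (2 ^ r)) * walsh_mat (2 ^ r)) $$ (i, j) = (1\<^sub>m (2 ^ r)) $$ (i, j)"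
    if "i < 2 ^ r" "j < 2 ^ r" for i j
  proof -
    have "(transpose_mat (walsh_mat (2 ^ r)) * walsh_mat (2 ^ r)) $$ (i, j) =
        (\<Sum>k<2 ^ r. walsh k i / sqrt (2 ^ r) * (walsh k j / sqrt (2 ^ r)))"
      using that by (simp add: walsh_mat_def scalar_prod_def lessThan_atLeast0)
    also have "\<dots> = (\<Sum>k<2 ^ r. walsh k i * walsh k j) / 2 ^ r"
      by (simp add: sum_divide_distrib)
    also have "\<dots> = (1\<^sub>m (2 ^ r)) $$ (i, j)"
      using that by (simp add: sum_walsh_mult)
    finally show ?thesis .
  qed
  then show ?thesis
    by (auto simp: orthogonal_group_def intro!: eq_matI) (auto simp: walsh_mat_def)
qed

text \<open>Every entry has square 1/d, so all columns give the same sum m/d and the maximum is over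
  a constant.\<close>

lemma kappa_walsh_mat:
  assumes "d > 0" "m > 0" "m \<le> d"
  shows "kappa {..<m} (walsh_mat d) = 1"
proof -
  have "(\<Sum>j<m. (walsh_mat d $$ (j, k))\<^sup>2) = real m / real d" if "k < d" for k
    using that assms by (simp add: walsh_mat_def power_divide)
  then have "(\<lambda>k. \<Sum>j<m. (walsh_mat d $$ (j, k))\<^sup>2) ` {..<d} = {real m / real d}"
    using assms(1) by force
  then show ?thesis
    using assms by (simp add: kappa_def walsh_mat_def)
qed

text \<open>The squared entries are all 1/d, so each weighted row sum is the squared norm of
  \<open>x\<close> divided by d.\<close>

lemma Theta_walsh_mat:
  assumes "d > 0" "x \<in> unit_sphere d"
  shows "Theta (walsh_mat d) {x} = 1"
proof -
  have x: "(\<Sum>j<d. (x $ j)\<^sup>2) = 1"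
    using assms(2) by (auto simp: unit_sphere_def l2_norm_def L2_set_def)
  have "(\<Sum>j<d. (walsh_mat d $$ (k, j))\<^sup>2 * (x $ j)\<^sup>2) = 1 / real d" if "k < d" for k
    using that by (simp add: walsh_mat_def power_divide x flip: sum_divide_distrib)
  then have "(\<lambda>(x, k). \<Sum>j<d. (walsh_mat d $$ (k, j))\<^sup>2 * (x $ j)\<^sup>2) ` ({x} \<times> {..<d}) = {1 / real d}"
    using assms(1) by force
  then show ?thesis
    using assms(1) by (simp add: Theta_def walsh_mat_def)
qed

subsection \<open>The image of the flat vector\<close>

definition flat_vec :: "nat \<Rightarrow> nat \<Rightarrow> real vec" where
  "flat_vec d s = vec d (\<lambda>j. if j < s then 1 / sqrt (real s) else 0)"

lemma flat_vec_carrier [simp]: "flat_vec d s \<in> carrier_vec d"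
  by (simp add: flat_vec_def)

lemma sum_restrict_lessThan:
  fixes f :: "nat \<Rightarrow> 'a::comm_monoid_add"
  assumes "s \<le> d"
  shows "(\<Sum>j<d. if j < s then f j else 0) = (\<Sum>j<s. f j)"
proof -
  have "{..<d} \<inter> {j. j < s} = {..<s}" using assms by auto
  then show ?thesis by (simp add: sum.If_cases)
qed

lemma flat_vec_unit:
  assumes "0 < s" "s \<le> d"
  shows "flat_vec d s \<in> unit_sphere d"
proof -
  have "(\<Sum>j<d. (flat_vec d s $ j)\<^sup>2) = (\<Sum>j<d. if j < s then 1 / real s else 0)"
    by (intro sum.cong) (auto simp: flat_vec_def power_divide)
  also have "\<dots> = 1" using assms by (simp add: sum_restrict_lessThan)
  finally show ?thesis
    by (simp add: unit_sphere_def l2_norm_def L2_set_def flat_vec_def)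
qed

lemma mat_diag_mult_vec:
  assumes "v \<in> carrier_vec d" "i < d"
  shows "(mat_diag d f *\<^sub>v v) $ i = f i * (v $ i :: 'a :: semiring_1)"
proof -
  have "(mat_diag d f *\<^sub>v v) $ i = (\<Sum>j = 0..<d. (if i = j then f j else 0) * v $ j)"
    using assms by (simp add: mat_diag_def scalar_prod_def)
  also have "\<dots> = (\<Sum>j = 0..<d. if i = j then f j * v $ j else 0)"
    by (intro sum.cong) auto
  also have "\<dots> = f i * v $ i" using assms by simp
  finally show ?thesis .
qed

lemma walsh_mat_mult_vec:
  assumes "v \<in> carrier_vec d" "i < d"
  shows "(walsh_mat d *\<^sub>v v) $ i = (\<Sum>j<d. walsh i j * v $ j) / sqrt (real d)"
  using assms by (simp add: walsh_mat_def scalar_prod_def lessThan_atLeast0 sum_divide_distrib)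

text \<open>Since s is a power of two, \<open>{..<s}\<close> is a subgroup of digit strings, and the
  transform of its indicator lives on the annihilator, the multiples of s. By symmetry of
  \<open>walsh\<close> this is \<open>sum_walsh\<close> with \<open>k\<close> as the fixed
  index.\<close>

lemma walsh_mat_flat_vec:
  assumes "s = 2 ^ t" "s \<le> d" "k < d" "\<And>j. j < s \<Longrightarrow> f j = 1"
  shows "(walsh_mat d *\<^sub>v (mat_diag d f *\<^sub>v flat_vec d s)) $ k =
    (if s dvd k then sqrt (real s / real d) else 0)"
proof -
  have car: "mat_diag d f *\<^sub>v flat_vec d s \<in> carrier_vec d"
    by (meson flat_vec_carrier mat_diag_dim mult_mat_vec_carrier)
  have "(\<Sum>j<d. walsh k j * (mat_diag d f *\<^sub>v flat_vec d s) $ j) =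
      (\<Sum>j<d. if j < s then walsh j k / sqrt (real s) else 0)"
    using assms(2,4)
    by (intro sum.cong) (auto simp: mat_diag_mult_vec flat_vec_def walsh_commute[of k])
  also have "\<dots> = (\<Sum>j<s. walsh j k) / sqrt (real s)"
    using assms(2) by (simp add: sum_restrict_lessThan sum_divide_distrib)
  also have "\<dots> = (if s dvd k then real s else 0) / sqrt (real s)"
    unfolding assms(1) by (subst sum_walsh) simp
  also have "\<dots> = (if s dvd k then sqrt (real s) else 0)"
    by (simp add: real_div_sqrt)
  finally show ?thesis
    by (simp add: walsh_mat_mult_vec[OF car assms(3)] real_sqrt_divide)
qed

section \<open>The factors of \<open>Phi\<close> and their action on vectors\<close>

lemma restrict_mat_carrier [simp]:
  assumes "m \<le> d" shows "restrict_mat d {..<m} \<in> carrier_mat m d"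
proof -
  have "{i. i < d \<and> i < m} = {..<m}" using assms by auto
  then show ?thesis
    by (intro carrier_matI) (simp_all add: restrict_mat_def dim_submatrix)
qed

lemma restrict_mat_mult_vec:
  assumes "m \<le> d" "v \<in> carrier_vec d" "i < m"
  shows "(restrict_mat d {..<m} *\<^sub>v v) $ i = v $ i"
proof -
  have card: "{i. i < d \<and> i < m} = {..<m}" using assms by auto
  \<comment> \<open>\<open>pick\<close> enumerates a set in increasing order; exactly
    \<open>i\<close> elements of an initial segment lie below \<open>i\<close>, so there it is the
    identity.\<close>
  have "{a \<in> {..<m}. a < i} = {..<i}" using assms by auto
  then have pick: "pick {..<m} i = i"
    using pick_card_in_set[of i "{..<m}"] assms by simp
  have dims: "dim_row (restrict_mat d {..<m}) = m" "dim_col (restrict_mat d {..<m}) = d"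
    using restrict_mat_carrier[OF assms(1)] by (simp_all del: restrict_mat_carrier)
  have entry: "restrict_mat d {..<m} $$ (i, j) = (if i = j then 1 else 0)" if "j < d" for j
    using that assms pick unfolding restrict_mat_def
    by (subst submatrix_index) (simp_all add: card pick_UNIV)
  have "(restrict_mat d {..<m} *\<^sub>v v) $ i = (\<Sum>j = 0..<d. (if i = j then 1 else 0) * v $ j)"
    using assms dims by (simp add: scalar_prod_def entry)
  also have "\<dots> = (\<Sum>j = 0..<d. if i = j then v $ j else 0)"
    by (intro sum.cong) auto
  also have "\<dots> = v $ i" using assms by simp
  finally show ?thesis .
qed

lemma perm_mat_carrier [simp]: "perm_mat d p \<in> carrier_mat d d"
  by (simp add: perm_mat_def)

text \<open>Applying the factors one after another allows coordinates to be followed vector by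
  vector, without computing entries of the matrix product.\<close>

lemma Phi_mult_vec:
  assumes "m \<le> d" "A \<in> carrier_mat d d" "B \<in> carrier_mat d d" "x \<in> carrier_vec d"
  shows "Phi d {..<m} A B (xi, p, xi') *\<^sub>v x = sqrt (real d / real m) \<cdot>\<^sub>v
    (restrict_mat d {..<m} *\<^sub>v (A *\<^sub>v (mat_diag d (\<lambda>i. xi $ i) *\<^sub>v (perm_mat d p *\<^sub>v
      (B *\<^sub>v (mat_diag d (\<lambda>i. xi' $ i) *\<^sub>v x))))))"
proof -
  have smult: "(c \<cdot>\<^sub>m M) *\<^sub>v v = c \<cdot>\<^sub>v (M *\<^sub>v v)"
    if "M \<in> carrier_mat m d" "v \<in> carrier_vec d" for M :: "real mat" and c v
    using that by (intro eq_vecI) (auto simp: scalar_prod_def sum_distrib_left mult.assoc)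
  let ?R = "restrict_mat d {..<m}" and ?D = "mat_diag d (\<lambda>i. xi $ i)" and ?P = "perm_mat d p"
  let ?E = "mat_diag d (\<lambda>i. xi' $ i)"
  have R: "?R \<in> carrier_mat m d" using assms by simp
  note car = assms R mat_diag_dim[of d] perm_mat_carrier[of d p] mult_carrier_mat mult_mat_vec_carrier
  have RA: "?R * A \<in> carrier_mat m d" using car by blast
  have RAD: "?R * A * ?D \<in> carrier_mat m d" using RA car by blast
  have RADP: "?R * A * ?D * ?P \<in> carrier_mat m d" using RAD car by blast
  have RADPB: "?R * A * ?D * ?P * B \<in> carrier_mat m d" using RADP car by blast
  have RADPBE: "?R * A * ?D * ?P * B * ?E \<in> carrier_mat m d" using RADPB car by blast
  have Ex: "?E *\<^sub>v x \<in> carrier_vec d" using car by blast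
  have BEx: "B *\<^sub>v (?E *\<^sub>v x) \<in> carrier_vec d" using Ex car by blast
  have PBEx: "?P *\<^sub>v (B *\<^sub>v (?E *\<^sub>v x)) \<in> carrier_vec d" using BEx car by blast
  have DPBEx: "?D *\<^sub>v (?P *\<^sub>v (B *\<^sub>v (?E *\<^sub>v x))) \<in> carrier_vec d" using PBEx car by blast
  show ?thesis
    unfolding Phi_def split_conv card_lessThan smult[OF RADPBE assms(4)]
    by (simp only: assoc_mult_mat_vec[OF RADPB mat_diag_dim assms(4)]
        assoc_mult_mat_vec[OF RADP assms(3) Ex] assoc_mult_mat_vec[OF RAD perm_mat_carrier BEx]
        assoc_mult_mat_vec[OF RA mat_diag_dim PBEx] assoc_mult_mat_vec[OF R assms(2) DPBEx])
qed

text \<open>Only the constant character on the rows is used: by Cauchy--Schwarz \<open>m \<parallel>v\<parallel>\<^sup>2 \<ge> (\<Sum>i. v $ i)\<^sup>2\<close>, and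
  summing the first \<open>m\<close> rows of the Walsh matrix annihilates all columns except the multiples of \<open>m\<close>.\<close>

lemma l2_norm_Phi_ge:
  assumes "m = 2 ^ r" "s = 2 ^ t" "m \<le> d" "s \<le> d" "p permutes {..<d}"
    "\<And>j. j < s \<Longrightarrow> xi' $ j = 1"
  shows "(l2_norm (Phi d {..<m} (walsh_mat d) (walsh_mat d) (xi, p, xi') *\<^sub>v flat_vec d s))\<^sup>2 \<ge>
    real s / real d * (\<Sum>j | j < d \<and> m dvd j \<and> s dvd p j. xi $ j)\<^sup>2"
proof -
  let ?y = "walsh_mat d *\<^sub>v (mat_diag d (\<lambda>i. xi' $ i) *\<^sub>v flat_vec d s)"
  let ?w = "mat_diag d (\<lambda>i. xi $ i) *\<^sub>v (perm_mat d p *\<^sub>v ?y)"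
  let ?v = "Phi d {..<m} (walsh_mat d) (walsh_mat d) (xi, p, xi') *\<^sub>v flat_vec d s"
  let ?c = "\<Sum>j | j < d \<and> m dvd j \<and> s dvd p j. xi $ j"
  have m: "m > 0" and d: "d > 0"
    using assms(1,3) by (auto intro: Nat.gr0I)
  have y: "?y \<in> carrier_vec d"
    by (meson flat_vec_carrier mat_diag_dim mult_mat_vec_carrier walsh_mat_carrier)
  then have Py: "perm_mat d p *\<^sub>v ?y \<in> carrier_vec d"
    by (meson perm_mat_carrier mult_mat_vec_carrier)
  then have w: "?w \<in> carrier_vec d"
    by (meson mat_diag_dim mult_mat_vec_carrier)
  then have Aw: "walsh_mat d *\<^sub>v ?w \<in> carrier_vec d"
    by (meson walsh_mat_carrier mult_mat_vec_carrier)
  \<comment> \<open>The permutation matrix reads coordinate \<open>p j\<close>, so the multiples of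
    s are pulled back along \<open>p\<close>.\<close>
  have w_eq: "?w $ j = (if s dvd p j then sqrt (real s / real d) * xi $ j else 0)" if "j < d" for j
  proof -
    have "p j < d" using that assms(5) permutes_in_image[of p "{..<d}" j] by simp
    then show ?thesis
      using that assms(6)
      by (simp add: mat_diag_mult_vec[OF Py] perm_mat_mult_vec[OF assms(5) y]
          walsh_mat_flat_vec[OF assms(2,4)])
  qed
  have v_eq: "?v = sqrt (real d / real m) \<cdot>\<^sub>v (restrict_mat d {..<m} *\<^sub>v (walsh_mat d *\<^sub>v ?w))"
    using assms(3) by (simp add: Phi_mult_vec)
  have dim_v: "dim_vec ?v = m"
    using restrict_mat_carrier[OF assms(3)] unfolding v_eq
    by (simp del: restrict_mat_carrier)
  \<comment> \<open>The scaling sqrt(d/m) and the normalisation 1/sqrt d of the Walsh matrix combine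
    to 1/sqrt m.\<close>
  have v: "?v $ i = (\<Sum>j<d. walsh i j * ?w $ j) / sqrt (real m)" if "i < m" for i
  proof -
    have "?v $ i = sqrt (real d / real m) * (walsh_mat d *\<^sub>v ?w) $ i"
      using that dim_v Aw assms(3) unfolding v_eq
      by (simp add: restrict_mat_mult_vec del: index_mult_mat_vec)
    also have "\<dots> = (\<Sum>j<d. walsh i j * ?w $ j) / sqrt (real m)"
      using that assms(3) d by (simp add: walsh_mat_mult_vec[OF w] real_sqrt_divide)
    finally show ?thesis .
  qed
  have "(\<Sum>i<m. ?v $ i) = (\<Sum>i<m. \<Sum>j<d. walsh i j * ?w $ j) / sqrt (real m)"
    by (simp add: v sum_divide_distrib)
  also have "(\<Sum>i<m. \<Sum>j<d. walsh i j * ?w $ j) = (\<Sum>j<d. (\<Sum>i<m. walsh i j) * ?w $ j)"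
    by (subst sum.swap) (simp add: sum_distrib_right)
  also have "\<dots> = (\<Sum>j<d. if m dvd j \<and> s dvd p j then m * sqrt (real s / real d) * xi $ j else 0)"
    unfolding assms(1) sum_walsh using w_eq by (intro sum.cong) auto
  also have "\<dots> = m * sqrt (real s / real d) * ?c"
    by (auto simp: sum.If_cases sum_distrib_left intro!: sum.cong)
  also have "\<dots> / sqrt (real m) = sqrt (real m) * sqrt (real s / real d) * ?c"
    using m by (simp add: real_div_sqrt field_simps)
  finally have sum_v: "(\<Sum>i<m. ?v $ i)\<^sup>2 = real m * (real s / real d * ?c\<^sup>2)"
    by (simp add: power_mult_distrib)
  have "(\<Sum>i<m. ?v $ i)\<^sup>2 \<le> (\<Sum>i<m. (?v $ i)\<^sup>2) * real m"
    using sum_squared_le_sum_of_squares[of "\<lambda>i. ?v $ i" "{..<m}"] by simp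
  also have "(\<Sum>i<m. (?v $ i)\<^sup>2) = (l2_norm ?v)\<^sup>2"
    unfolding l2_norm_def L2_set_def dim_v by (simp add: sum_nonneg del: index_mult_mat_vec)
  finally have "real m * (real s / real d * ?c\<^sup>2) \<le> real m * (l2_norm ?v)\<^sup>2"
    unfolding sum_v by (simp add: mult.commute)
  then show ?thesis
    using m by (subst (asm) mult_le_cancel_left_pos) simp_all
qed

subsection \<open>The probability estimate\<close>

text \<open>One event for both sign vectors: it is used for \<xi> with the fixed points of \<pi> and
  for \<xi>' with the support of the flat vector.\<close>

definition fixed_signs :: "nat \<Rightarrow> nat set \<Rightarrow> real vec set" where
  "fixed_signs d K = {v \<in> sign_vecs d. \<forall>i\<in>K. v $ i = 1}"

lemma fixed_signs_empty [simp]: "fixed_signs d {} = sign_vecs d"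
  by (simp add: fixed_signs_def)

text \<open>Such vectors correspond to extensional functions with one admissible value on
  \<open>K\<close> and two elsewhere.\<close>

lemma card_fixed_signs:
  assumes "K \<subseteq> {..<d}"
  shows "card (fixed_signs d K) = 2 ^ (d - card K)"
proof -
  define P where "P = ({..<d} \<rightarrow>\<^sub>E {-1, 1 :: real}) \<inter> {f. \<forall>i\<in>K. f i = 1}"
  have P: "P = (\<Pi>\<^sub>E i\<in>{..<d}. if i \<in> K then {1} else {-1, 1})"
    using assms unfolding P_def by (auto simp: PiE_iff split: if_splits)
  have "inj_on (vec d) P"
  proof (rule inj_onI)
    fix f g assume fg: "f \<in> P" "g \<in> P" "vec d f = vec d g"
    then have "f i = g i" if "i \<in> {..<d}" for i
      using that by (metis index_vec lessThan_iff)
    with fg(1,2) show "f = g"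
      unfolding P_def by (intro PiE_ext[of f "{..<d}"]) auto
  qed
  moreover have "vec d ` P = fixed_signs d K"
  proof (intro equalityI subsetI)
    fix v assume "v \<in> fixed_signs d K"
    then have v: "v \<in> carrier_vec d" "\<And>i. i < d \<Longrightarrow> v $ i \<in> {-1, 1}" "\<And>i. i \<in> K \<Longrightarrow> v $ i = 1"
      by (auto simp: fixed_signs_def sign_vecs_def)
    then have "v = vec d (restrict (\<lambda>i. v $ i) {..<d})"
      by (intro eq_vecI) auto
    moreover have "restrict (\<lambda>i. v $ i) {..<d} \<in> P"
      using v assms by (auto simp: P_def PiE_iff)
    ultimately show "v \<in> vec d ` P" by blast
  next
    fix v assume "v \<in> vec d ` P"
    then show "v \<in> fixed_signs d K"
      using assms by (force simp: P_def fixed_signs_def sign_vecs_def PiE_iff)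
  qed
  ultimately have "card (fixed_signs d K) = card P"
    by (metis card_image)
  also have "\<dots> = (\<Prod>i<d. if i \<in> K then 1 else 2)"
    unfolding P by (subst card_PiE) (auto intro!: prod.cong)
  also have "\<dots> = 2 ^ (d - card K)"
  proof -
    have "{..<d} \<inter> - {i. i \<in> K} = {..<d} - K" by auto
    moreover have "card ({..<d} - K) = d - card K"
      using assms by (simp add: card_Diff_subset finite_subset)
    ultimately show ?thesis by (simp add: prod.If_cases)
  qed
  finally show ?thesis .
qed

lemma prob_fixed_signs:
  assumes "K \<subseteq> {..<d}"
  shows "measure_pmf.prob (pmf_of_set (sign_vecs d)) (fixed_signs d K) = (1 / 2) ^ card K"
proof -
  have "card K \<le> d"
    using card_mono[OF _ assms] by simp
  moreover have "sign_vecs d \<inter> fixed_signs d K = fixed_signs d K"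
    by (auto simp: fixed_signs_def)
  moreover have "card (sign_vecs d) = 2 ^ d"
    using card_fixed_signs[of "{}" d] by simp
  ultimately have "measure_pmf.prob (pmf_of_set (sign_vecs d)) (fixed_signs d K) =
      2 ^ (d - card K) / 2 ^ d"
    using assms by (simp add: measure_pmf_of_set sign_vecs_nonempty finite_sign_vecs card_fixed_signs)
  also have "(2 :: real) ^ d = 2 ^ (d - card K) * 2 ^ card K"
    using \<open>card K \<le> d\<close> by (simp flip: power_add)
  finally show ?thesis
    by (simp add: power_divide)
qed

text \<open>With k = \<open>card K\<close>, fixing \<open>K\<close> pointwise leaves (d - k)! of the
  d! permutations, and the falling factorial d!/(d - k)! is at most d^k.\<close>

lemma prob_permutes_diff_ge:
  assumes "K \<subseteq> {..<d}"
  shows "measure_pmf.prob (pmf_of_set {p. p permutes {..<d}}) {p. p permutes {..<d} - K}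
    \<ge> 1 / real d ^ card K"
proof -
  have le: "card K \<le> d"
    using card_mono[OF _ assms] by simp
  have "{p. p permutes {..<d}} \<noteq> {}"
    using permutes_id by blast
  moreover have "{p. p permutes {..<d}} \<inter> {p. p permutes {..<d} - K} = {p. p permutes {..<d} - K}"
    using permutes_subset[of _ "{..<d} - K" "{..<d}"] by auto
  moreover have "card ({..<d} - K) = d - card K"
    using assms by (simp add: card_Diff_subset finite_subset)
  ultimately have eq: "measure_pmf.prob (pmf_of_set {p. p permutes {..<d}}) {p. p permutes {..<d} - K} =
      fact (d - card K) / fact d"
    by (simp add: measure_pmf_of_set finite_permutations card_permutations)
  have "fact d = (fact d div fact (d - card K)) * (fact (d - card K) :: nat)"
    by (simp add: fact_dvd)
  also have "\<dots> \<le> d ^ card K * fact (d - card K)"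
    using fact_div_fact_le_pow[OF le] by (intro mult_right_mono) auto
  finally have "real (fact d) \<le> real (d ^ card K * fact (d - card K))"
    by (simp only: of_nat_le_iff)
  then have "fact d \<le> real d ^ card K * fact (d - card K)"
    by simp
  \<comment> \<open>For d = 0 the set \<open>K\<close> is empty and the power is 0^0 = 1.\<close>
  moreover have "real d ^ card K > 0"
    using le by (cases "d = 0") auto
  ultimately show ?thesis
    unfolding eq by (simp add: divide_simps mult.commute)
qed

text \<open>The flip keeps the coherent contribution of \<open>K\<close> and negates the
  uncontrolled contribution of all other coordinates.\<close>

definition flip :: "nat \<Rightarrow> nat set \<Rightarrow> real vec \<Rightarrow> real vec" where
  "flip d K v = vec d (\<lambda>i. if i \<in> K then v $ i else - v $ i)"

text \<open>The flip is an involution of the finite set of sign vectors, hence preserves the uniform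
  law.\<close>

lemma map_pmf_flip: "map_pmf (flip d K) (pmf_of_set (sign_vecs d)) = pmf_of_set (sign_vecs d)"
proof -
  have "flip d K v \<in> sign_vecs d" "flip d K (flip d K v) = v" if "v \<in> sign_vecs d" for v
    using that by (auto simp: flip_def sign_vecs_def)
  then have "bij_betw (flip d K) (sign_vecs d) (sign_vecs d)"
    by (intro bij_betw_byWitness[of _ "flip d K"]) auto
  then show ?thesis
    by (rule map_pmf_of_set_bij_betw) (simp_all add: sign_vecs_nonempty finite_sign_vecs)
qed

lemma map_pmf_flip_sign_perm: "map_pmf (apfst (flip d K)) (sign_perm_pmf d) = sign_perm_pmf d"
  by (simp add: sign_perm_pmf_def map_pmf_flip flip: pair_map_pmf1)

text \<open>Flipping the signs outside \<open>K\<close> preserves the law, so a favourable event need only occur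
  for one of each pair of outcomes exchanged by the flip.\<close>

lemma prob_sign_perm_ge:
  assumes "K \<subseteq> {..<d}" "S \<subseteq> {..<d}"
    and E: "\<And>xi p xi'. xi \<in> fixed_signs d K \<Longrightarrow> p permutes {..<d} - K \<Longrightarrow> xi' \<in> fixed_signs d S \<Longrightarrow>
      (xi, p, xi') \<in> E \<or> (flip d K xi, p, xi') \<in> E"
  shows "measure_pmf.prob (sign_perm_pmf d) E \<ge> (1 / 2) ^ (card K + card S + 1) / real d ^ card K"
proof -
  define F where "F = fixed_signs d K \<times> {p. p permutes {..<d} - K} \<times> fixed_signs d S"
  let ?P = "measure_pmf.prob (sign_perm_pmf d)"
  have fin: "finite (fixed_signs d K)" for K
    by (rule finite_subset[OF _ finite_sign_vecs]) (auto simp: fixed_signs_def)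
  have finp: "finite {p. p permutes {..<d} - K}"
    by (simp add: finite_permutations)
  have "?P F = (1 / 2) ^ card K *
      (measure_pmf.prob (pmf_of_set {p. p permutes {..<d}}) {p. p permutes {..<d} - K} *
        (1 / 2) ^ card S)"
    unfolding sign_perm_pmf_def F_def using assms(1,2) fin finp
    by (simp add: measure_pmf_prob_product countable_finite prob_fixed_signs)
  also have "\<dots> \<ge> (1 / 2) ^ card K * (1 / real d ^ card K * (1 / 2) ^ card S)"
    using prob_permutes_diff_ge[OF assms(1)] by (intro mult_left_mono mult_right_mono) auto
  finally have F_ge: "(1 / 2) ^ (card K + card S) / real d ^ card K \<le> ?P F"
    by (simp add: power_add mult_ac)
  have "F \<subseteq> E \<union> apfst (flip d K) -` E"
  proof
    fix \<omega> assume "\<omega> \<in> F"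
    then obtain xi p xi' where "\<omega> = (xi, p, xi')" "xi \<in> fixed_signs d K" "p permutes {..<d} - K"
      "xi' \<in> fixed_signs d S"
      by (auto simp: F_def)
    with E[of xi p xi'] show "\<omega> \<in> E \<union> apfst (flip d K) -` E"
      by auto
  qed
  then have "?P F \<le> ?P (E \<union> apfst (flip d K) -` E)"
    by (intro measure_pmf.finite_measure_mono) auto
  also have "\<dots> \<le> ?P E + ?P (apfst (flip d K) -` E)"
    by (intro measure_Un_le) auto
  \<comment> \<open>Both parts of the union are equally likely, so the union bound costs a factor 2:
    this is the \<open>+ 1\<close> in the exponent.\<close>
  also have "?P (apfst (flip d K) -` E) = ?P E"
    by (subst (2) map_pmf_flip_sign_perm[of d K, symmetric]) (simp only: measure_map_pmf)
  finally have "?P F \<le> ?P E * 2" by simp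
  then have "(1 / 2) ^ (card K + card S) / real d ^ card K \<le> ?P E * 2"
    by (rule order_trans[OF F_ge])
  then have "(1 / 2) ^ (card K + card S) / real d ^ card K / 2 \<le> ?P E"
    by (subst pos_divide_le_eq) simp_all
  then show ?thesis by (simp add: power_add mult_ac)
qed

text \<open>The permutation fixes k multiples of m, which are also multiples of s because s divides
  m. They contribute k to the signed sum. A sum of absolute value at least k forces squared norm at
  least k^2 s/d, hence at least 4, which is at distance at least 3 from 1.\<close>

lemma prob_l2_norm_Phi_ge:
  fixes d m s k r t :: nat
  assumes "d = 2 ^ (2 * r)" "m = 2 ^ r" "s = 2 ^ t" "t \<le> r" "k \<le> m" "4 * d \<le> k\<^sup>2 * s"
  shows "measure_pmf.prob (sign_perm_pmf d) {\<omega>.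
      \<bar>(l2_norm (Phi d {..<m} (walsh_mat d) (walsh_mat d) \<omega> *\<^sub>v flat_vec d s))\<^sup>2 - 1\<bar> \<ge> 3}
    \<ge> (1 / 2) ^ (k + s + 1) / real d ^ k"
proof -
  \<comment> \<open>There are d/m = m multiples of m below d, so k \<le> m leaves room for the first
    k of them.\<close>
  define K where "K = (\<lambda>i. i * m) ` {..<k}"
  have d: "d = m * m" and m: "m > 0"
    using assms by (simp_all add: power_add mult_2)
  have K: "K \<subseteq> {..<d}"
  proof
    fix j assume "j \<in> K"
    then obtain i where "i < k" "j = i * m" by (auto simp: K_def)
    then show "j \<in> {..<d}" using assms(5) m unfolding d by simp
  qed
  have card_K: "card K = k"
    unfolding K_def using m by (subst card_image) (auto simp: inj_on_def)
  have sm: "s dvd m"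
    unfolding assms(2,3) using assms(4) by (rule le_imp_power_dvd)
  have "m \<le> d" using m unfolding d by simp
  have "s \<le> d" using dvd_imp_le[OF sm m] \<open>m \<le> d\<close> by simp
  let ?N = "\<lambda>\<omega>. (l2_norm (Phi d {..<m} (walsh_mat d) (walsh_mat d) \<omega> *\<^sub>v flat_vec d s))\<^sup>2"
  have "3 \<le> \<bar>?N (xi, p, xi') - 1\<bar> \<or> 3 \<le> \<bar>?N (flip d K xi, p, xi') - 1\<bar>"
    if xi: "xi \<in> fixed_signs d K" and p: "p permutes {..<d} - K" and xi': "xi' \<in> fixed_signs d {..<s}"
    for xi p xi'
  proof -
    define J where "J = {j. j < d \<and> m dvd j \<and> s dvd p j}"
    \<comment> \<open>Other indices may also satisfy both divisibility conditions; nothing is known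
      about their signed sum \<open>b\<close>, and the flip replaces it by
      \<open>- b\<close>.\<close>
    define b where "b = (\<Sum>j\<in>J - K. xi $ j)"
    have pd: "p permutes {..<d}" using p by (rule permutes_subset) auto
    have KJ: "K \<subseteq> J"
    proof
      fix j assume j: "j \<in> K"
      then have "p j = j" using p by (auto intro: permutes_not_in)
      moreover have "m dvd j" using j by (auto simp: K_def)
      moreover have "s dvd j" using sm \<open>m dvd j\<close> by (rule dvd_trans)
      ultimately show "j \<in> J" using j K by (auto simp: J_def)
    qed
    have fin: "finite J" by (simp add: J_def)
    have "(\<Sum>j\<in>K. xi $ j) = k"
      using xi by (simp add: fixed_signs_def card_K)
    then have c1: "(\<Sum>j\<in>J. xi $ j) = k + b"
      using sum.subset_diff[OF KJ fin, of "\<lambda>j. xi $ j"] by (simp add: b_def)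
    have "(\<Sum>j\<in>K. flip d K xi $ j) = (\<Sum>j\<in>K. xi $ j)"
      using K by (intro sum.cong) (auto simp: flip_def)
    moreover have "(\<Sum>j\<in>J - K. flip d K xi $ j) = - b"
      unfolding b_def sum_negf[symmetric] by (intro sum.cong) (auto simp: flip_def J_def)
    ultimately have c2: "(\<Sum>j\<in>J. flip d K xi $ j) = k - b"
      using sum.subset_diff[OF KJ fin, of "\<lambda>j. flip d K xi $ j"] \<open>(\<Sum>j\<in>K. xi $ j) = k\<close> by simp
    have N: "real s / real d * (\<Sum>j\<in>J. z $ j)\<^sup>2 \<le> ?N (z, p, xi')" for z
      unfolding J_def
      by (rule l2_norm_Phi_ge[OF assms(2,3) \<open>m \<le> d\<close> \<open>s \<le> d\<close> pd])
        (use xi' in \<open>simp add: fixed_signs_def\<close>)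
    have big: "4 \<le> real s / real d * c\<^sup>2" if "real k \<le> \<bar>c\<bar>" for c :: real
    proof -
      have "4 * real d \<le> (real k)\<^sup>2 * real s"
        using assms(6) by (metis of_nat_le_iff of_nat_mult of_nat_numeral of_nat_power)
      also have "\<dots> \<le> c\<^sup>2 * real s"
        using that by (intro mult_right_mono) (simp_all add: abs_le_square_iff[symmetric])
      finally show ?thesis
        using m by (simp add: d field_simps)
    qed
    \<comment> \<open>The two numbers average to k, so one of them is at least k whatever the sign
      of \<open>b\<close>.\<close>
    have "real k \<le> \<bar>k + b\<bar> \<or> real k \<le> \<bar>k - b\<bar>" by linarith
    then show ?thesis
    proof
      assume "real k \<le> \<bar>k + b\<bar>"
      with big[of "k + b"] N[of xi] have "4 \<le> ?N (xi, p, xi')"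
        unfolding c1 by linarith
      then show ?thesis by simp
    next
      assume "real k \<le> \<bar>k - b\<bar>"
      with big[of "k - b"] N[of "flip d K xi"] have "4 \<le> ?N (flip d K xi, p, xi')"
        unfolding c2 by linarith
      then show ?thesis by simp
    qed
  qed
  then have "measure_pmf.prob (sign_perm_pmf d) {\<omega>. \<bar>?N \<omega> - 1\<bar> \<ge> 3}
      \<ge> (1 / 2) ^ (card K + card {..<s} + 1) / real d ^ card K"
    using \<open>s \<le> d\<close> by (intro prob_sign_perm_ge[OF K]) auto
  then show ?thesis by (simp add: card_K)
qed

section \<open>Choice of the parameters s and k\<close>

text \<open>Rounding the binary logarithm up costs at most a factor 2; this makes the support size a
  power of two.\<close>

lemma ex_power_two_between:
  assumes "L \<ge> (1 :: real)"
  obtains t :: nat where "L \<le> 2 ^ t" "2 ^ t \<le> 2 * L"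
proof
  define t where "t = nat \<lceil>log 2 L\<rceil>"
  have "log 2 L \<ge> 0" using assms by simp
  then have t: "log 2 L \<le> real t" "real t \<le> log 2 L + 1"
    unfolding t_def by linarith+
  have "L = 2 powr (log 2 L)" using assms by simp
  also have "\<dots> \<le> 2 powr (real t)" using t by (intro powr_mono) auto
  finally show "L \<le> 2 ^ t" by (simp add: powr_realpow)
  have "2 powr (real t) \<le> 2 powr (log 2 L + 1)" using t by (intro powr_mono) auto
  also have "\<dots> = 2 * L" using assms by (simp add: powr_add)
  finally show "2 ^ t \<le> 2 * L" by (simp add: powr_realpow)
qed

text \<open>\<open>L\<close> is the solution of \<open>\<surd>(d/L) ln d = L\<close>, where the costs of \<open>\<xi>'\<close> and \<open>\<pi>\<close> balance.\<close>

lemma exponent_bound: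
  fixes d L s k :: real
  assumes L: "L = d powr (1/3) * ln d powr (2/3)"
    and "0 < d" "ln d \<ge> 1" "L \<ge> 1" "L \<le> s" "s \<le> 2 * L" "0 \<le> k" "k \<le> 3 * sqrt (d / s)"
  shows "(k + s + 1) * ln 2 + k * ln d \<le> 9 * L"
proof -
  \<comment> \<open>Cubing removes the fractional exponents and yields the balance equation in
    polynomial form.\<close>
  have "L ^ 3 = d * (ln d)\<^sup>2"
  proof -
    have "ln d > 0" using assms(3) by linarith
    then have "(d powr (1/3)) ^ 3 = d" "(ln d powr (2/3)) ^ 3 = (ln d)\<^sup>2"
      using assms(2) by (simp_all add: powr_power)
    then show ?thesis by (simp add: L power_mult_distrib)
  qed
  then have "L\<^sup>2 = d / L * (ln d)\<^sup>2"
    using assms(4) by (simp add: field_simps power3_eq_cube power2_eq_square)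
  then have "(sqrt (d / L) * ln d)\<^sup>2 = L\<^sup>2"
    using assms(2) assms(4) by (simp add: power_mult_distrib)
  moreover have "0 \<le> sqrt (d / L) * ln d"
    using assms(2-4) by (intro mult_nonneg_nonneg real_sqrt_ge_zero divide_nonneg_nonneg) linarith+
  ultimately have balance: "sqrt (d / L) * ln d = L"
    by (rule power2_eq_imp_eq) (use assms(4) in linarith)
  have "sqrt (d / s) \<le> sqrt (d / L)"
    using assms by (intro real_sqrt_le_mono divide_left_mono mult_pos_pos) linarith+
  then have "k \<le> 3 * sqrt (d / L)"
    using assms(8) by linarith
  then have "k * ln d \<le> 3 * sqrt (d / L) * ln d"
    by (rule mult_right_mono) (use assms in linarith)
  then have kd: "k * ln d \<le> 3 * L"
    using balance by simp
  have "k * 1 \<le> k * ln d"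
    using assms by (intro mult_left_mono) linarith+
  moreover have "(k + s + 1) * ln 2 \<le> k + s + 1"
    using mult_left_mono[of "ln 2" 1 "k + s + 1"] assms(4,5,7) ln_2_less_1 by simp
  moreover define a b where "a = (k + s + 1) * ln 2" and "b = k * ln d"
  \<comment> \<open>The signs cost at most k + s + 1 \<le> 3L + 2L + L, using k \<le> k ln d, and
    the permutation costs at most 3L.\<close>
  ultimately have "a + b \<le> 9 * L"
    using kd assms(4,6) by linarith
  then show ?thesis
    by (simp only: a_def b_def)
qed

theorem theorem7p1:
  shows "\<exists>C > (0::real). \<exists>r0 :: nat. \<forall>r \<ge> r0. \<forall>(d :: nat) (m :: nat) (I :: nat set).
    d = 2 ^ (2 * r) \<longrightarrow> real m = sqrt (real d) \<longrightarrow> I = {..<m} \<longrightarrow>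
    (\<exists>A \<in> orthogonal_group d. \<exists>B \<in> orthogonal_group d. \<exists>x \<in> unit_sphere d.
       kappa I A = 1 \<and> Theta B {x} = 1 \<and>
       measure_pmf.prob (sign_perm_pmf d)
           {\<omega>. \<bar>(l2_norm (Phi d I A B \<omega> *\<^sub>v x))\<^sup>2 - 1\<bar> \<ge> 3}
         \<ge> exp (- C * real d powr (1/3) * (ln (real d)) powr (2/3)))"
proof -
  \<comment> \<open>The first bound gives s \<ge> 4 and hence k \<le> m, the second gives s \<le> m
    and hence t \<le> r, and the third serves \<open>exponent_bound\<close>.\<close>
  have "\<forall>\<^sub>F x :: real in at_top. 4 \<le> x powr (1/3) * ln x powr (2/3) \<and>
      2 * (x powr (1/3) * ln x powr (2/3)) \<le> sqrt x \<and> 1 \<le> ln x"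
    by (intro eventually_conj; real_asymp)
  then obtain d0 where d0: "\<And>x :: real. x \<ge> d0 \<Longrightarrow> 4 \<le> x powr (1/3) * ln x powr (2/3) \<and>
      2 * (x powr (1/3) * ln x powr (2/3)) \<le> sqrt x \<and> 1 \<le> ln x"
    by (auto simp: eventually_at_top_linorder)
  obtain r0 :: nat where r0: "real r0 \<ge> d0"
    using real_arch_simple by blast
  show ?thesis
  proof (intro exI[of _ "9 :: real"] conjI exI[of _ r0] allI impI)
    fix r d m :: nat and I :: "nat set"
    assume r: "r \<ge> r0" and d: "d = 2 ^ (2 * r)" and m: "real m = sqrt (real d)" and I: "I = {..<m}"
    define L where "L = real d powr (1/3) * ln (real d) powr (2/3)"
    have "r0 < 2 ^ (2 * r)"
      using r less_exp[of "2 * r"] by linarith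
    then have "d0 \<le> real d"
      using r0 unfolding d by (metis less_imp_le of_nat_less_iff order_trans)
    then have L: "4 \<le> L" "2 * L \<le> sqrt (real d)" and ln_d: "1 \<le> ln (real d)"
      using d0 unfolding L_def by blast+
    have m2: "m = 2 ^ r"
    proof -
      have "sqrt (real d) = 2 ^ r"
        by (simp add: d power_mult[of _ r 2] mult.commute[of 2 r])
      then show ?thesis using m by (metis of_nat_eq_iff of_nat_numeral of_nat_power)
    qed
    obtain t where t: "L \<le> 2 ^ t" "2 ^ t \<le> 2 * L"
      using L(1) by (auto intro: ex_power_two_between[of L])
    define s :: nat where "s = 2 ^ t"
    \<comment> \<open>This is the least natural number with k^2 s \<ge> 4d.\<close>
    define k where "k = nat \<lceil>2 * sqrt (real d / real s)\<rceil>"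
    have s: "L \<le> real s" "real s \<le> 2 * L" using t by (simp_all add: s_def)
    have "real s \<le> real m" using s L m by linarith
    then have "t \<le> r" by (simp add: s_def m2)
    have "m > 0" by (simp add: m2)
    have d_mm: "d = m * m" by (simp add: d m2 power_add mult_2)
    then have "m \<le> d" using \<open>m > 0\<close> by simp
    then have "s \<le> d" using \<open>real s \<le> real m\<close> by simp
    \<comment> \<open>This absorbs the rounding error of the ceiling: k \<le> 2y + 1 \<le> 3y for y
      = sqrt(d/s).\<close>
    have "1 \<le> sqrt (real d / real s)"
      using \<open>s \<le> d\<close> by (simp add: s_def)
    then have k: "2 * sqrt (real d / real s) \<le> real k" "real k \<le> 3 * sqrt (real d / real s)"
      unfolding k_def by linarith+
    \<comment> \<open>As m is an integer, it bounds the ceiling once it bounds 2 sqrt(d/s), which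
      follows from s \<ge> 4.\<close>
    have "k \<le> m"
    proof -
      have "sqrt (real d / real s) \<le> sqrt (real d / 4)"
        using s L by (intro real_sqrt_le_mono divide_left_mono) auto
      also have "\<dots> = sqrt (real d) / 2"
        by (simp add: real_sqrt_divide)
      finally have "2 * sqrt (real d / real s) \<le> real m"
        unfolding m by simp
      then show ?thesis unfolding k_def by linarith
    qed
    have "4 * d \<le> k\<^sup>2 * s"
    proof -
      have "(2 * sqrt (real d / real s))\<^sup>2 \<le> (real k)\<^sup>2"
        using k by (intro power_mono) auto
      then have "4 * real d \<le> (real k)\<^sup>2 * real s"
        by (simp add: power_mult_distrib s_def field_simps)
      then show ?thesis
        by (metis of_nat_le_iff of_nat_mult of_nat_numeral of_nat_power)
    qed
    note prob = prob_l2_norm_Phi_ge[OF d m2 s_def \<open>t \<le> r\<close> \<open>k \<le> m\<close> this]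
    have "exp (- 9 * L) \<le> exp (- ((real k + real s + 1) * ln 2 + real k * ln (real d)))"
      using exponent_bound[OF L_def _ ln_d _ s, of "real k"] k(2) L(1) \<open>m > 0\<close> \<open>m \<le> d\<close> by simp
    also have "\<dots> = (1 / 2) ^ (k + s + 1) / real d ^ k"
    proof -
      have "exp (real n * ln c) = c ^ n" if "c > 0" for n :: nat and c :: real
        using that by (simp add: exp_of_nat_mult)
      from this[of 2 "k + s + 1"] this[of "real d" k] \<open>m > 0\<close> show ?thesis
        by (simp add: exp_minus exp_add exp_diff d_mm power_divide field_simps)
    qed
    finally have "exp (- 9 * real d powr (1/3) * (ln (real d)) powr (2/3)) \<le>
        (1 / 2) ^ (k + s + 1) / real d ^ k"
      by (simp add: L_def mult.assoc)
    with prob have "measure_pmf.prob (sign_perm_pmf d) {\<omega>.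
        \<bar>(l2_norm (Phi d I (walsh_mat d) (walsh_mat d) \<omega> *\<^sub>v flat_vec d s))\<^sup>2 - 1\<bar> \<ge> 3}
      \<ge> exp (- 9 * real d powr (1/3) * (ln (real d)) powr (2/3))"
      unfolding I by linarith
    moreover have "walsh_mat d \<in> orthogonal_group d"
      unfolding d by (rule walsh_mat_orthogonal)
    moreover have "flat_vec d s \<in> unit_sphere d"
      using \<open>s \<le> d\<close> by (intro flat_vec_unit) (simp_all add: s_def)
    moreover have "kappa I (walsh_mat d) = 1"
      unfolding I using \<open>m > 0\<close> \<open>m \<le> d\<close> by (intro kappa_walsh_mat) auto
    moreover have "Theta (walsh_mat d) {flat_vec d s} = 1"
      using \<open>m > 0\<close> \<open>m \<le> d\<close> \<open>flat_vec d s \<in> unit_sphere d\<close> by (intro Theta_walsh_mat) auto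
    ultimately show "\<exists>A \<in> orthogonal_group d. \<exists>B \<in> orthogonal_group d. \<exists>x \<in> unit_sphere d.
       kappa I A = 1 \<and> Theta B {x} = 1 \<and>
       measure_pmf.prob (sign_perm_pmf d)
           {\<omega>. \<bar>(l2_norm (Phi d I A B \<omega> *\<^sub>v x))\<^sup>2 - 1\<bar> \<ge> 3}
         \<ge> exp (- 9 * real d powr (1/3) * (ln (real d)) powr (2/3))"
      by blast
  qed simp
qed

end
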